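(* Let $G$ be a $2$-connected nontrivial uniquely $C_9$-saturated graph, let $C=[c_0,c_1,\dots,c_7]$ (indices modulo $8$) be a longest even cycle among the even cycles of $G$ of length at most $12$, assumed to have length $8$, and let $R=V(G)\setminus V(C)$. Then no vertex of $R$ has two neighbours on $C$ at $C$-distance $2$. Consequently, for every $x\in R$ the set $N_C(x)=N(x)\cap V(C)$ is empty, a singleton, a distance-$3$ pair $\{c_i,c_{i+3}\}$, or an antipodal pair $\{c_i,c_{i+4}\}$.
   Context: All graphs are finite and simple. A graph $G$ is uniquely $C_9$-saturated if it contains no cycle of length $9$ and, for every edge $e$ of the complement $\overline{G}$, $G+e$ contains exactly one cycle of length $9$; it is nontrivial if $|V(G)|\ge 9$. The $C$-distance of $c_i,c_j$ ($0\le i,j\le 7$) is $\min(|i-j|,8-|i-j|)$. *)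

theory Defs
  imports "HOL-Library.Ramsey"
begin

text \<open>A graph is given by its vertex set \<open>V\<close> and its edge set \<open>E\<close>, a set of two-element
  subsets of \<open>V\<close>; \<open>[V]\<^bsup>2\<^esup>\<close> is the set of all two-element subsets of \<open>V\<close>.\<close>

definition simple_graph :: "'a set \<Rightarrow> 'a set set \<Rightarrow> bool" where
  "simple_graph V E \<longleftrightarrow> finite V \<and> E \<subseteq> [V]\<^bsup>2\<^esup>"

definition neighbours :: "'a set set \<Rightarrow> 'a \<Rightarrow> 'a set" where
  "neighbours E x = {y. {x, y} \<in> E}"

definition connected_graph :: "'a set \<Rightarrow> 'a set set \<Rightarrow> bool" where
  "connected_graph V E \<longleftrightarrow>
     V \<noteq> {} \<and> (\<forall>u\<in>V. \<forall>v\<in>V. (u, v) \<in> {(x, y). {x, y} \<in> E}\<^sup>*)"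

text \<open>More than \<open>k\<close> vertices, and deleting fewer than \<open>k\<close> vertices never disconnects.\<close>

definition k_connected :: "nat \<Rightarrow> 'a set \<Rightarrow> 'a set set \<Rightarrow> bool" where
  "k_connected k V E \<longleftrightarrow>
     k < card V \<and>
     (\<forall>X\<subseteq>V. card X < k \<longrightarrow> connected_graph (V - X) {e \<in> E. e \<subseteq> V - X})"

text \<open>A cyclic vertex sequence \<open>cs\<close> lists a cycle starting from some vertex, in some direction.
  The cycle itself, as a subgraph, is determined by its edge set \<open>cycle_edges cs\<close>; this is what is
  counted, so rotations and reversals of \<open>cs\<close> are the same cycle.\<close>

definition cycle_edges :: "'a list \<Rightarrow> 'a set set" where
  "cycle_edges cs = {{cs ! i, cs ! (Suc i mod length cs)} | i. i < length cs}"

definition is_cycle :: "'a set set \<Rightarrow> 'a list \<Rightarrow> bool" where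
  "is_cycle E cs \<longleftrightarrow> 3 \<le> length cs \<and> distinct cs \<and> cycle_edges cs \<subseteq> E"

definition cycles_of_length :: "nat \<Rightarrow> 'a set set \<Rightarrow> 'a set set set" where
  "cycles_of_length k E = {cycle_edges cs | cs. is_cycle E cs \<and> length cs = k}"

definition uniquely_cycle_saturated :: "nat \<Rightarrow> 'a set \<Rightarrow> 'a set set \<Rightarrow> bool" where
  "uniquely_cycle_saturated k V E \<longleftrightarrow>
     cycles_of_length k E = {} \<and>
     (\<forall>e \<in> [V]\<^bsup>2\<^esup> - E. \<exists>!Z. Z \<in> cycles_of_length k (insert e E))"

definition longest_even_cycle_upto :: "nat \<Rightarrow> 'a set set \<Rightarrow> 'a list \<Rightarrow> bool" where
  "longest_even_cycle_upto m E cs \<longleftrightarrow>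
     is_cycle E cs \<and> even (length cs) \<and> length cs \<le> m \<and>
     (\<forall>ds. is_cycle E ds \<and> even (length ds) \<and> length ds \<le> m \<longrightarrow> length ds \<le> length cs)"

text \<open>Distance along an 8-cycle between the vertices with indices \<open>i\<close> and \<open>j\<close>, for
  \<open>0 \<le> i, j \<le> 7\<close>; integers are used so that the subtractions do not truncate.\<close>

definition cdist :: "nat \<Rightarrow> nat \<Rightarrow> int" where
  "cdist i j = min \<bar>int i - int j\<bar> (8 - \<bar>int i - int j\<bar>)"

end

theory Submission
  imports Defs
begin

text \<open>Let \<open>G\<close> be uniquely \<open>C\<^sub>n\<^sub>+\<^sub>1\<close>-saturated, for any \<open>n\<close>, and let \<open>C\<close> be a cycle
  of length \<open>n\<close> in \<open>G\<close>. A vertex \<open>x\<close> off \<open>C\<close> cannot be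
  adjacent to two consecutive vertices of \<open>C\<close>, since \<open>x\<close> could be inserted between them to give a
  cycle of length \<open>n + 1\<close> (\<open>no_two_consecutive_neighbours\<close>). Nor can it be adjacent to the two
  neighbours \<open>a\<close> and \<open>d\<close> on \<open>C\<close> of a vertex \<open>b\<close>: then \<open>x\<close> and \<open>b\<close> are nonadjacent, and they are
  interchangeable with respect to the path \<open>d, \<dots>, a\<close> that remains when \<open>b\<close> is deleted from \<open>C\<close>.
  That path can be run in either direction, as \<open>b, d, \<dots>, a, x\<close> or as \<open>x, d, \<dots>, a, b\<close>, so adding
  the edge \<open>xb\<close> closes two different cycles of length \<open>n + 1\<close>
  (\<open>no_two_neighbours_around_a_vertex\<close>).

  For \<open>n = 8\<close> the neighbours of \<open>x\<close> on \<open>C\<close> are therefore pairwise at distance 3 or 4, and three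
  such vertices would need a cycle of length at least 9
  (\<open>index_sets_without_distance_1_or_2\<close>).\<close>

text \<open>Appending the first vertex at the end turns the modular indices of \<open>cycle_edges\<close> into
  consecutive list entries, so that cycles can be cut and rearranged by list operations.\<close>

lemma cycle_edges_subset_iff_successively:
  assumes "cs \<noteq> []"
  shows "cycle_edges cs \<subseteq> F \<longleftrightarrow> successively (\<lambda>u v. {u, v} \<in> F) (cs @ [hd cs])"
proof -
  have closing: "(cs @ [hd cs]) ! Suc i = cs ! (Suc i mod length cs)" if "i < length cs" for i
  proof (cases "Suc i = length cs")
    case True
    then show ?thesis using assms by (simp add: nth_append hd_conv_nth)
  next
    case False
    then show ?thesis using that by (simp add: nth_append)
  qed
  have "successively (\<lambda>u v. {u, v} \<in> F) (cs @ [hd cs]) \<longleftrightarrow>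
      (\<forall>i < length cs. {cs ! i, cs ! (Suc i mod length cs)} \<in> F)"
    unfolding successively_conv_nth using closing by (auto simp: nth_append)
  then show ?thesis
    unfolding cycle_edges_def by blast
qed

lemma is_cycle_iff_successively:
  "is_cycle F cs \<longleftrightarrow>
     3 \<le> length cs \<and> distinct cs \<and> successively (\<lambda>u v. {u, v} \<in> F) (cs @ [hd cs])"
  unfolding is_cycle_def using cycle_edges_subset_iff_successively[of cs F] by fastforce

lemma is_cycle_rotate:
  assumes "is_cycle F cs"
  shows "is_cycle F (rotate m cs)"
proof (induction m)
  case 0
  then show ?case using assms by simp
next
  case (Suc m)
  have "2 \<le> length (rotate m cs)"
    using Suc unfolding is_cycle_def by simp
  then obtain u v ws where "rotate m cs = u # v # ws"
    by (metis Suc_le_length_iff numeral_2_eq_2)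
  then show ?case
    using Suc by (auto simp: is_cycle_iff_successively successively_append_iff successively_Cons hd_append)
qed

lemma is_cycle_mono:
  assumes "is_cycle F cs" "F \<subseteq> F'"
  shows "is_cycle F' cs"
  using assms unfolding is_cycle_def by blast

lemma cycle_vertices_subset:
  assumes "simple_graph V E" "is_cycle E cs"
  shows "set cs \<subseteq> V"
proof
  fix v assume "v \<in> set cs"
  then obtain i where "i < length cs" "v = cs ! i"
    by (metis in_set_conv_nth)
  then have "{v, cs ! (Suc i mod length cs)} \<in> E"
    using assms(2) unfolding is_cycle_def cycle_edges_def by blast
  then show "v \<in> V"
    using assms(1) unfolding simple_graph_def nsets_def by blast
qed

lemma no_two_consecutive_neighbours:
  assumes sat: "uniquely_cycle_saturated (Suc (length c)) V E"
    and cyc: "is_cycle E c" and c: "c = a # b # ys"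
    and x: "x \<notin> set c" "{x, a} \<in> E"
  shows "{x, b} \<notin> E"
proof
  assume "{x, b} \<in> E"
  then have "is_cycle E (a # x # b # ys)"
    using cyc x unfolding is_cycle_iff_successively c
    by (auto simp: insert_commute)
  then have "cycle_edges (a # x # b # ys) \<in> cycles_of_length (Suc (length c)) E"
    unfolding cycles_of_length_def c by force
  then show False
    using sat unfolding uniquely_cycle_saturated_def by blast
qed

lemma no_two_neighbours_around_a_vertex:
  assumes graph: "simple_graph V E"
    and sat: "uniquely_cycle_saturated (Suc (length c)) V E"
    and cyc: "is_cycle E c" and c: "c = a # b # d # ys"
    and x: "x \<in> V" "x \<notin> set c" "{x, a} \<in> E"
  shows "{x, d} \<notin> E"
proof
  assume xd: "{x, d} \<in> E"
  define F where "F = insert {x, b} E"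
  have "{x, b} \<notin> E"
    using no_two_consecutive_neighbours[OF sat cyc c x(2,3)] .
  moreover have "{x, b} \<in> [V]\<^bsup>2\<^esup>"
    using cycle_vertices_subset[OF graph cyc] x c by (auto simp: nsets_def card_2_iff)
  ultimately have unique: "Y = Z"
    if "Y \<in> cycles_of_length (Suc (length c)) F" "Z \<in> cycles_of_length (Suc (length c)) F" for Y Z
    using sat that unfolding uniquely_cycle_saturated_def F_def by blast
  have cycF: "is_cycle F c"
    using is_cycle_mono[OF cyc] unfolding F_def by blast
  have edges: "{x, a} \<in> F" "{a, x} \<in> F" "{x, d} \<in> F" "{x, b} \<in> F" "{b, x} \<in> F"
    using x xd unfolding F_def by (auto simp: insert_commute)
  have "is_cycle F (x # b # d # ys @ [a])"
    using cycF edges x unfolding is_cycle_iff_successively c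
    by (auto simp: successively_append_iff successively_Cons hd_append)
  then have first: "cycle_edges (x # b # d # ys @ [a]) \<in> cycles_of_length (Suc (length c)) F"
    unfolding cycles_of_length_def c by force
  have "is_cycle F (x # d # ys @ [a, b])"
    using cycF edges x unfolding is_cycle_iff_successively c
    by (auto simp: successively_append_iff successively_Cons hd_append)
  then have second: "cycle_edges (x # d # ys @ [a, b]) \<in> cycles_of_length (Suc (length c)) F"
    unfolding cycles_of_length_def c by force
  \<comment> \<open>The two cycles differ in the edge \<open>xa\<close>: in the second one \<open>x\<close> lies between \<open>b\<close> and \<open>d\<close>.\<close>
  have "{x, a} \<in> cycle_edges (x # b # d # ys @ [a])"
    using cycle_edges_subset_iff_successively[of "x # b # d # ys @ [a]" "cycle_edges (x # b # d # ys @ [a])"]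
    by (auto simp: successively_append_iff successively_Cons insert_commute)
  moreover have "{x, a} \<notin> cycle_edges (x # d # ys @ [a, b])"
  proof -
    have ne: "a \<noteq> b" "a \<noteq> d" "x \<noteq> a" "x \<noteq> b" "x \<noteq> d" "x \<notin> set ys"
      using cyc x unfolding is_cycle_def c by auto
    have "successively (\<lambda>u v. {u, v} \<in> - {{x, a}}) (d # ys @ [a, b])"
      by (rule successively_mono[where P = "\<lambda>_ _. True"])
        (use ne in \<open>auto simp: doubleton_eq_iff successively_conv_nth\<close>)
    then have "successively (\<lambda>u v. {u, v} \<in> - {{x, a}}) ((x # d # ys @ [a, b]) @ [x])"
      using ne by (auto simp: successively_append_iff successively_Cons doubleton_eq_iff)
    then show ?thesis
      using cycle_edges_subset_iff_successively[of "x # d # ys @ [a, b]" "- {{x, a}}"] by auto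
  qed
  ultimately show False
    using unique[OF first second] by simp
qed

lemma no_neighbours_at_distance_1_or_2:
  assumes graph: "simple_graph V E"
    and sat: "uniquely_cycle_saturated (Suc (length c)) V E"
    and cyc: "is_cycle E c"
    and x: "x \<in> V - set c" and i: "i < length c" "{x, c ! i} \<in> E"
  shows "{x, c ! ((i + 1) mod length c)} \<notin> E" and "{x, c ! ((i + 2) mod length c)} \<notin> E"
proof -
  have cyc': "is_cycle E (rotate i c)"
    using is_cycle_rotate[OF cyc] .
  then have len: "3 \<le> length c"
    unfolding is_cycle_def by simp
  then have nth: "rotate i c ! 0 = c ! i" "rotate i c ! 1 = c ! ((i + 1) mod length c)"
      "rotate i c ! 2 = c ! ((i + 2) mod length c)"
    using i(1) len length_greater_0_conv[of c] nth_rotate[of 0 c i] nth_rotate[of 1 c i] nth_rotate[of 2 c i]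
    by (simp_all del: length_greater_0_conv)
  have "3 \<le> length (rotate i c)"
    using len by simp
  then obtain a b d ys where r: "rotate i c = a # b # d # ys"
    by (metis Suc_le_length_iff numeral_3_eq_3)
  have sat': "uniquely_cycle_saturated (Suc (length (rotate i c))) V E"
    using sat by simp
  have x': "x \<in> V" "x \<notin> set (rotate i c)" "{x, a} \<in> E"
    using x i(2) nth(1) r set_rotate[of i c] by (blast, blast, simp)
  show "{x, c ! ((i + 1) mod length c)} \<notin> E"
    using no_two_consecutive_neighbours[OF sat' cyc' r x'(2,3)] nth r by simp
  show "{x, c ! ((i + 2) mod length c)} \<notin> E"
    using no_two_neighbours_around_a_vertex[OF graph sat' cyc' r x'] nth r by simp
qed

lemma less_8_cases:
  "(i::nat) < 8 \<Longrightarrow>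
    i = 0 \<or> i = 1 \<or> i = 2 \<or> i = 3 \<or> i = 4 \<or> i = 5 \<or> i = 6 \<or> i = 7"
  by linarith

text \<open>Three elements are impossible because the three gaps between cyclically consecutive ones
  sum to 8, so they cannot all be at least 3.\<close>

lemma index_sets_without_distance_1_or_2:
  fixes A :: "nat set"
  assumes bound: "A \<subseteq> {..<8}"
    and gap: "\<And>i. i \<in> A \<Longrightarrow> (i + 1) mod 8 \<notin> A" "\<And>i. i \<in> A \<Longrightarrow> (i + 2) mod 8 \<notin> A"
  shows "A = {} \<or> (\<exists>i<8. A = {i}) \<or> (\<exists>i<8. A = {i, (i + 3) mod 8})
    \<or> (\<exists>i<8. A = {i, (i + 4) mod 8})"
proof (cases "A = {}")
  case False
  then obtain i where i: "i \<in> A" "i < 8"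
    using bound by auto
  have near: "k \<in> {i, (i + 3) mod 8, (i + 4) mod 8, (i + 5) mod 8}" if "k \<in> A" for k
  proof -
    have "k < 8"
      using that bound by auto
    have "k \<noteq> (i + 1) mod 8" "k \<noteq> (i + 2) mod 8"
        "i \<noteq> (k + 1) mod 8" "i \<noteq> (k + 2) mod 8"
      using gap i that by auto
    then show ?thesis
      using less_8_cases[OF i(2)] less_8_cases[OF \<open>k < 8\<close>] by (elim disjE) simp_all
  qed
  have far: "(i + 4) mod 8 \<notin> A" "(i + 5) mod 8 \<notin> A" if "(i + 3) mod 8 \<in> A"
    using gap[OF that] by (simp_all add: mod_simps ac_simps)
  have far': "(i + 5) mod 8 \<notin> A" if "(i + 4) mod 8 \<in> A"
    using gap[OF that] by (simp_all add: mod_simps ac_simps)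
  consider "(i + 3) mod 8 \<in> A" | "(i + 4) mod 8 \<in> A" | "(i + 5) mod 8 \<in> A"
    | "A = {i}"
    using near i by blast
  then show ?thesis
  proof cases
    case 1
    then have "A = {i, (i + 3) mod 8}" using near far i by blast
    then show ?thesis using i by blast
  next
    case 2
    then have "A = {i, (i + 4) mod 8}" using near far far' i by blast
    then show ?thesis using i by blast
  next
    \<comment> \<open>Distance 3 counted from the other end, as \<open>5 + 3 = 8\<close>.\<close>
    case 3
    then have "A = {(i + 5) mod 8, i}" using near far far' i by blast
    moreover have "((i + 5) mod 8 + 3) mod 8 = i" "(i + 5) mod 8 < 8"
      using i by (simp_all add: mod_simps ac_simps)
    ultimately show ?thesis by metis
  qed (use i in blast)
qed simp

theorem lemma7p7:
  fixes V :: "'a set" and E :: "'a set set" and c :: "'a list"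
  assumes "simple_graph V E"
    and "k_connected 2 V E"
    and "9 \<le> card V"
    and "uniquely_cycle_saturated 9 V E"
    and "longest_even_cycle_upto 12 E c"
    and "length c = 8"
  shows "(\<forall>x \<in> V - set c. \<not> (\<exists>i<8. \<exists>j<8. cdist i j = 2 \<and>
            c ! i \<in> neighbours E x \<and> c ! j \<in> neighbours E x))
       \<and> (\<forall>x \<in> V - set c.
            neighbours E x \<inter> set c = {}
          \<or> (\<exists>i<8. neighbours E x \<inter> set c = {c ! i})
          \<or> (\<exists>i<8. neighbours E x \<inter> set c = {c ! i, c ! ((i + 3) mod 8)})
          \<or> (\<exists>i<8. neighbours E x \<inter> set c = {c ! i, c ! ((i + 4) mod 8)}))"
proof -
  have cyc: "is_cycle E c"
    using assms(5) unfolding longest_even_cycle_upto_def by simp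
  have sat: "uniquely_cycle_saturated (Suc (length c)) V E"
    using assms(4,6) by simp
  note gaps = no_neighbours_at_distance_1_or_2[OF assms(1) sat cyc, unfolded assms(6)]
  have "\<not> (cdist i j = 2 \<and> c ! i \<in> neighbours E x \<and> c ! j \<in> neighbours E x)"
    if x: "x \<in> V - set c" and ij: "i < 8" "j < 8" for x i j
  proof
    assume *: "cdist i j = 2 \<and> c ! i \<in> neighbours E x \<and> c ! j \<in> neighbours E x"
    then have "j = (i + 2) mod 8 \<or> i = (j + 2) mod 8"
      using less_8_cases[OF ij(1)] less_8_cases[OF ij(2)] by (elim disjE) (simp_all add: cdist_def)
    then show False
      using gaps(2)[OF x ij(1)] gaps(2)[OF x ij(2)] * unfolding neighbours_def by auto
  qed
  moreover have "neighbours E x \<inter> set c = {}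
      \<or> (\<exists>i<8. neighbours E x \<inter> set c = {c ! i})
      \<or> (\<exists>i<8. neighbours E x \<inter> set c = {c ! i, c ! ((i + 3) mod 8)})
      \<or> (\<exists>i<8. neighbours E x \<inter> set c = {c ! i, c ! ((i + 4) mod 8)})"
    if x: "x \<in> V - set c" for x
  proof -
    define A where "A = {i. i < 8 \<and> {x, c ! i} \<in> E}"
    have image: "neighbours E x \<inter> set c = (!) c ` A"
      unfolding neighbours_def A_def set_conv_nth assms(6) by auto
    have "A = {} \<or> (\<exists>i<8. A = {i}) \<or> (\<exists>i<8. A = {i, (i + 3) mod 8})
        \<or> (\<exists>i<8. A = {i, (i + 4) mod 8})"
      by (rule index_sets_without_distance_1_or_2) (use gaps[OF x] in \<open>auto simp: A_def\<close>)
    then show ?thesis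
      unfolding image by (elim disjE exE conjE) auto
  qed
  ultimately show ?thesis
    by blast
qed

end
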